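(* Let $E_1,\dots,E_m$ and $F$ be Banach spaces and $T\in\mathcal{L}(E_1,\dots,E_m;F)$. Then $T\in\mathcal{L}_{WDP^{*}}^{\mathrm{ev}}(E_1,\dots,E_m;F)$ if and only if, for every $(a_1,\dots,a_m)\in E_1\times\cdots\times E_m$, every family of weakly null sequences $(x_j^{(i)})_{j=1}^{\infty}\subset E_i$, $i=1,\dots,m$, and every sequence $(f_j)_{j=1}^{\infty}\subset F'$ with $f_j\overset{w^*}{\longrightarrow}f\in F'$, we have $$f_j\big(T(x_j^{(1)}+a_1,\dots,x_j^{(m)}+a_m)\big)\longrightarrow f\big(T(a_1,\dots,a_m)\big).$$
   Context: Banach spaces are over $\mathbb{K}=\mathbb{R}$ or $\mathbb{C}$; $F'$ is the topological dual of $F$; $\overset{w}{\to}$ denotes weak convergence of sequences and $\overset{w^*}{\to}$ denotes convergence of sequences in $F'$ for $\sigma(F',F)$; $\mathcal{L}(E_1,\dots,E_m;F)$ is the space of continuous $m$-linear operators. $T\in\mathcal{L}_{WDP^{*}}^{\mathrm{ev}}(E_1,\dots,E_m;F)$ (weakly* Dunford–Pettis at every point) if for all $(a_1,\dots,a_m)\in E_1\times\cdots\times E_m$, all sequences $x_j^{(i)}\overset{w}{\to}a_i$ in $E_i$ ($i=1,\dots,m$), and all sequences $f_j\overset{w^*}{\to}f$ in $F'$ with $f\in F'$, one has $f_j(T(x_j^{(1)},\dots,x_j^{(m)}))\to f(T(a_1,\dots,a_m))$. *)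

theory Defs
  imports "HOL-Analysis.Analysis" "HOL-Algebra.Module"
begin

section \<open>Normed and Banach spaces with explicit carriers\<close>

text \<open>
  The scalar field is a type \<open>'k\<close> of class \<open>real_normed_field\<close>; by the Gelfand--Mazur theorem this
  means exactly that it is isometrically isomorphic to \<open>real\<close> or \<open>complex\<close>.

  Spaces are records with an explicit carrier, so that a family \<open>E 1, \<dots>, E m\<close> of unrelated
  spaces can be indexed by a natural number. The type \<open>'v\<close> only provides the elements: every space
  has its own carrier, operations and norm, and any finite family of Banach spaces can be realised on
  the disjoint union of the underlying sets. The ring multiplication and unit that the record
  \<open>module\<close> inherits from \<open>ring\<close> play no role.
\<close>

definition scalar_ring :: "'k::real_normed_field ring" where
  "scalar_ring = \<lparr>carrier = UNIV, mult = (*), one = 1, zero = 0, add = (+)\<rparr>"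

lemma cring_scalar_ring: "cring (scalar_ring :: 'k::real_normed_field ring)"
proof (rule cringI)
  show "abelian_group (scalar_ring :: 'k ring)"
    by (rule abelian_groupI) (auto simp: scalar_ring_def intro: exI[of _ "- _"] ab_left_minus)
  show "Group.comm_monoid (scalar_ring :: 'k ring)"
    by (rule comm_monoidI) (auto simp: scalar_ring_def)
qed (auto simp: scalar_ring_def algebra_simps)

record ('k, 'v) nspace = "('k, 'v) module" +
  vnorm :: "'v \<Rightarrow> real"

locale normed_space = module scalar_ring V
  for V :: "('k::real_normed_field, 'v) nspace" (structure) +
  assumes vnorm_nonneg: "x \<in> carrier V \<Longrightarrow> 0 \<le> vnorm V x"
    and vnorm_eq_zero: "x \<in> carrier V \<Longrightarrow> vnorm V x = 0 \<longleftrightarrow> x = \<zero>\<^bsub>V\<^esub>"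
    and vnorm_smult: "x \<in> carrier V \<Longrightarrow> vnorm V (c \<odot>\<^bsub>V\<^esub> x) = norm c * vnorm V x"
    and vnorm_triangle:
      "\<lbrakk>x \<in> carrier V; y \<in> carrier V\<rbrakk> \<Longrightarrow> vnorm V (x \<oplus>\<^bsub>V\<^esub> y) \<le> vnorm V x + vnorm V y"

text \<open>The value 0 off the carrier is forced by \<open>Metric_space\<close>, whose distance is required to be
  nonnegative and symmetric on the whole type.\<close>

definition vdist :: "('k::real_normed_field, 'v) nspace \<Rightarrow> 'v \<Rightarrow> 'v \<Rightarrow> real" where
  "vdist V x y = (if x \<in> carrier V \<and> y \<in> carrier V then vnorm V (x \<ominus>\<^bsub>V\<^esub> y) else 0)"

context normed_space
begin

lemma vnorm_a_inv:
  assumes "x \<in> carrier V"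
  shows "vnorm V (\<ominus>\<^bsub>V\<^esub> x) = vnorm V x"
proof -
  have zero: "\<zero>\<^bsub>V\<^esub> = (0::'k) \<odot>\<^bsub>V\<^esub> x"
  proof -
    have "(0::'k) \<odot>\<^bsub>V\<^esub> x \<oplus>\<^bsub>V\<^esub> 0 \<odot>\<^bsub>V\<^esub> x = 0 \<odot>\<^bsub>V\<^esub> x"
      using smult_l_distr[of 0 0 x] assms by (simp add: scalar_ring_def)
    moreover have "(0::'k) \<odot>\<^bsub>V\<^esub> x \<in> carrier V"
      using smult_closed[of 0 x] assms by (simp add: scalar_ring_def)
    ultimately show ?thesis
      by (metis M.add.l_cancel_one')
  qed
  have "(-1::'k) \<odot>\<^bsub>V\<^esub> x \<oplus>\<^bsub>V\<^esub> x = \<zero>\<^bsub>V\<^esub>"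
    using smult_l_distr[of "-1" 1 x] smult_one[of x] assms zero by (simp add: scalar_ring_def)
  moreover have "(-1::'k) \<odot>\<^bsub>V\<^esub> x \<in> carrier V"
    using smult_closed[of "-1" x] assms by (simp add: scalar_ring_def)
  ultimately have "\<ominus>\<^bsub>V\<^esub> x = (-1::'k) \<odot>\<^bsub>V\<^esub> x"
    using assms M.minus_equality by blast
  then show ?thesis
    using vnorm_smult[OF assms, of "-1"] by simp
qed

lemma Metric_space_vdist: "Metric_space (carrier V) (vdist V)"
proof
  show "0 \<le> vdist V x y" for x y
    by (simp add: vdist_def vnorm_nonneg)
  show "vdist V x y = vdist V y x" for x y
  proof (cases "x \<in> carrier V \<and> y \<in> carrier V")
    case True
    then have "\<ominus>\<^bsub>V\<^esub> (x \<ominus>\<^bsub>V\<^esub> y) = y \<ominus>\<^bsub>V\<^esub> x"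
      by (simp add: M.minus_add a_minus_def M.minus_minus M.a_comm)
    then show ?thesis
      using True vnorm_a_inv[of "x \<ominus>\<^bsub>V\<^esub> y"] by (simp add: vdist_def)
  qed (auto simp: vdist_def)
  show "vdist V x y = 0 \<longleftrightarrow> x = y" if "x \<in> carrier V" "y \<in> carrier V" for x y
  proof -
    have "x = y" if "x \<ominus>\<^bsub>V\<^esub> y = \<zero>\<^bsub>V\<^esub>"
      using that \<open>x \<in> carrier V\<close> \<open>y \<in> carrier V\<close> M.minus_equality[of x "\<ominus>\<^bsub>V\<^esub> y"]
      by (simp add: a_minus_def)
    then show ?thesis
      using that by (auto simp: vdist_def vnorm_eq_zero a_minus_def M.r_neg)
  qed
  show "vdist V x z \<le> vdist V x y + vdist V y z"
    if "x \<in> carrier V" "y \<in> carrier V" "z \<in> carrier V" for x y z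
  proof -
    have "x \<ominus>\<^bsub>V\<^esub> z = (x \<ominus>\<^bsub>V\<^esub> y) \<oplus>\<^bsub>V\<^esub> (y \<ominus>\<^bsub>V\<^esub> z)"
      using that by (simp add: a_minus_def M.a_assoc M.r_neg1)
    then show ?thesis
      using that vnorm_triangle[of "x \<ominus>\<^bsub>V\<^esub> y" "y \<ominus>\<^bsub>V\<^esub> z"] by (simp add: vdist_def)
  qed
qed

end

locale banach_space = normed_space +
  assumes complete: "Metric_space.mcomplete (carrier V) (vdist V)"

definition norm_topology :: "('k::real_normed_field, 'v) nspace \<Rightarrow> 'v topology" where
  "norm_topology V = Metric_space.mtopology (carrier V) (vdist V)"


section \<open>Dual space, weak and weak* convergence\<close>

definition dual :: "('k::real_normed_field, 'v) nspace \<Rightarrow> ('v \<Rightarrow> 'k) set" where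
  "dual V = {\<phi> \<in> extensional (carrier V).
     (\<forall>x\<in>carrier V. \<forall>y\<in>carrier V. \<phi> (x \<oplus>\<^bsub>V\<^esub> y) = \<phi> x + \<phi> y) \<and>
     (\<forall>c. \<forall>x\<in>carrier V. \<phi> (c \<odot>\<^bsub>V\<^esub> x) = c * \<phi> x) \<and>
     continuous_map (norm_topology V) euclidean \<phi>}"

text \<open>\<open>\<sigma>(V, V')\<close>: the initial topology on \<open>V\<close> for all \<open>\<phi> \<in> V'\<close>.\<close>

definition weak_topology :: "('k::real_normed_field, 'v) nspace \<Rightarrow> 'v topology" where
  "weak_topology V = pullback_topology (carrier V) (\<lambda>x. \<lambda>\<phi>\<in>dual V. \<phi> x)
     (product_topology (\<lambda>_. euclidean) (dual V))"

text \<open>\<open>\<sigma>(V', V)\<close>: the topology of pointwise convergence on \<open>V'\<close>.\<close>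

definition weak_star_topology :: "('k::real_normed_field, 'v) nspace \<Rightarrow> ('v \<Rightarrow> 'k) topology" where
  "weak_star_topology V =
     subtopology (product_topology (\<lambda>_. euclidean) (carrier V)) (dual V)"

text \<open>\<open>limitin\<close> only constrains the terms of a sequence eventually, hence the extra membership
  conditions.\<close>

definition weakly_converges :: "('k::real_normed_field, 'v) nspace \<Rightarrow> (nat \<Rightarrow> 'v) \<Rightarrow> 'v \<Rightarrow> bool" where
  "weakly_converges V x a \<longleftrightarrow>
     range x \<subseteq> carrier V \<and> limitin (weak_topology V) x a sequentially"

definition weak_star_converges ::
  "('k::real_normed_field, 'v) nspace \<Rightarrow> (nat \<Rightarrow> 'v \<Rightarrow> 'k) \<Rightarrow> ('v \<Rightarrow> 'k) \<Rightarrow> bool" where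
  "weak_star_converges V f g \<longleftrightarrow>
     range f \<subseteq> dual V \<and> limitin (weak_star_topology V) f g sequentially"


section \<open>Continuous multilinear operators\<close>

text \<open>Points of \<open>E 1 \<times> \<dots> \<times> E m\<close> are functions in \<open>\<Pi>\<^sub>E i\<in>{1..m}. carrier (E i)\<close>.\<close>

definition cont_multilinear ::
  "nat \<Rightarrow> (nat \<Rightarrow> ('k::real_normed_field, 'e) nspace) \<Rightarrow> ('k, 'f) nspace \<Rightarrow>
   ((nat \<Rightarrow> 'e) \<Rightarrow> 'f) set" where
  "cont_multilinear m E F = {T \<in> (\<Pi>\<^sub>E i\<in>{1..m}. carrier (E i)) \<rightarrow>\<^sub>E carrier F.
     (\<forall>x\<in>(\<Pi>\<^sub>E i\<in>{1..m}. carrier (E i)). \<forall>i\<in>{1..m}. \<forall>u\<in>carrier (E i).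
        (\<forall>v\<in>carrier (E i). T (x(i := u \<oplus>\<^bsub>E i\<^esub> v)) = T (x(i := u)) \<oplus>\<^bsub>F\<^esub> T (x(i := v))) \<and>
        (\<forall>c. T (x(i := c \<odot>\<^bsub>E i\<^esub> u)) = c \<odot>\<^bsub>F\<^esub> T (x(i := u)))) \<and>
     continuous_map (product_topology (\<lambda>i. norm_topology (E i)) {1..m}) (norm_topology F) T}"

text \<open>Operators that are weakly* Dunford--Pettis at every point; \<open>x i j\<close> is the \<open>j\<close>-th term of the
  sequence in \<open>E i\<close>.\<close>

definition WDPstar_ev ::
  "nat \<Rightarrow> (nat \<Rightarrow> ('k::real_normed_field, 'e) nspace) \<Rightarrow> ('k, 'f) nspace \<Rightarrow>
   ((nat \<Rightarrow> 'e) \<Rightarrow> 'f) set" where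
  "WDPstar_ev m E F = {T \<in> cont_multilinear m E F.
     \<forall>a\<in>(\<Pi>\<^sub>E i\<in>{1..m}. carrier (E i)).
     \<forall>x. (\<forall>i\<in>{1..m}. weakly_converges (E i) (x i) (a i)) \<longrightarrow>
     (\<forall>f g. weak_star_converges F f g \<longrightarrow>
       (\<lambda>j. f j (T (\<lambda>i\<in>{1..m}. x i j))) \<longlonglongrightarrow> g (T a))}"

end

theory Submission
  imports Defs
begin

text \<open>Translation by a fixed vector carries weakly null sequences to sequences converging
  weakly to that vector, and translation by its inverse carries them back. Hence, coordinate by
  coordinate, the sequences tending weakly to \<open>a i\<close> are exactly the translates by
  \<open>a i\<close> of weakly null ones, and both sides of the equivalence test the same scalar
  sequences. The translation facts are \<open>weakly_converges_add_const\<close> and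
  \<open>weakly_converges_minus_limit\<close>. Both rest on \<open>weakly_converges_iff\<close>,
  which reduces weak convergence to limits of scalars, where additivity of functionals
  applies.\<close>

lemma limitin_pullback_topology:
  assumes "range x \<subseteq> A"
  shows "limitin (pullback_topology A f S) x a net \<longleftrightarrow>
    a \<in> A \<and> limitin S (\<lambda>j. f (x j)) (f a) net"
proof -
  have "x j \<in> A" for j
    using assms by auto
  then have "(\<forall>\<^sub>F j in net. x j \<in> f -` U \<inter> A) \<longleftrightarrow> (\<forall>\<^sub>F j in net. f (x j) \<in> U)" for U
    by simp
  then show ?thesis
    unfolding limitin_def topspace_pullback_topology openin_pullback_topology
    by (auto; metis IntI vimageI)
qed

text \<open>The weak topology is pulled back from a product with one factor per functional, and
  convergence in a product is coordinatewise.\<close>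

lemma weakly_converges_iff:
  "weakly_converges V x a \<longleftrightarrow>
    range x \<subseteq> carrier V \<and> a \<in> carrier V \<and> (\<forall>\<phi>\<in>dual V. (\<lambda>j. \<phi> (x j)) \<longlonglongrightarrow> \<phi> a)"
  by (auto simp: weakly_converges_def weak_topology_def limitin_pullback_topology
      limitin_componentwise)

lemma dual_add:
  assumes "\<phi> \<in> dual V" "u \<in> carrier V" "v \<in> carrier V"
  shows "\<phi> (u \<oplus>\<^bsub>V\<^esub> v) = \<phi> u + \<phi> v"
  using assms by (auto simp: dual_def)

context normed_space
begin

lemma dual_zero:
  assumes "\<phi> \<in> dual V"
  shows "\<phi> \<zero>\<^bsub>V\<^esub> = 0"
  using dual_add[OF assms M.zero_closed M.zero_closed] by simp

text \<open>Additivity applied to \<open>u\<close> written as the sum of the difference and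
  \<open>v\<close>.\<close>

lemma dual_minus:
  assumes "\<phi> \<in> dual V" "u \<in> carrier V" "v \<in> carrier V"
  shows "\<phi> (u \<ominus>\<^bsub>V\<^esub> v) = \<phi> u - \<phi> v"
proof -
  have "(u \<ominus>\<^bsub>V\<^esub> v) \<oplus>\<^bsub>V\<^esub> v = u"
    using assms by (simp add: a_minus_def M.a_assoc M.l_neg)
  then show ?thesis
    using dual_add[OF assms(1) M.minus_closed[OF assms(2,3)] assms(3)] by (simp add: eq_diff_eq)
qed

lemma weakly_converges_add_const:
  assumes "weakly_converges V x \<zero>\<^bsub>V\<^esub>" "a \<in> carrier V"
  shows "weakly_converges V (\<lambda>j. x j \<oplus>\<^bsub>V\<^esub> a) a"
proof -
  have x: "x j \<in> carrier V" for j
    using assms by (auto simp: weakly_converges_iff)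
  have "(\<lambda>j. \<phi> (x j \<oplus>\<^bsub>V\<^esub> a)) \<longlonglongrightarrow> \<phi> a" if "\<phi> \<in> dual V" for \<phi>
  proof -
    have "(\<lambda>j. \<phi> (x j)) \<longlonglongrightarrow> 0"
      using assms that by (auto simp: weakly_converges_iff dual_zero)
    \<comment> \<open>By additivity the sequence in question is \<phi> of the null sequence plus the
      constant \<open>\<phi> a\<close>.\<close>
    from tendsto_add[OF this tendsto_const[of "\<phi> a"]] show ?thesis
      using that x assms by (simp add: dual_add)
  qed
  then show ?thesis
    using x assms by (auto simp: weakly_converges_iff)
qed

lemma weakly_converges_minus_limit:
  assumes "weakly_converges V x a"
  shows "weakly_converges V (\<lambda>j. x j \<ominus>\<^bsub>V\<^esub> a) \<zero>\<^bsub>V\<^esub>"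
proof -
  have x: "x j \<in> carrier V" and a: "a \<in> carrier V" for j
    using assms by (auto simp: weakly_converges_iff)
  have "(\<lambda>j. \<phi> (x j \<ominus>\<^bsub>V\<^esub> a)) \<longlonglongrightarrow> \<phi> \<zero>\<^bsub>V\<^esub>" if "\<phi> \<in> dual V" for \<phi>
  proof -
    have "(\<lambda>j. \<phi> (x j)) \<longlonglongrightarrow> \<phi> a"
      using assms that by (auto simp: weakly_converges_iff)
    from tendsto_diff[OF this tendsto_const[of "\<phi> a"]] show ?thesis
      using that x a by (simp add: dual_minus dual_zero)
  qed
  then show ?thesis
    using x a by (auto simp: weakly_converges_iff)
qed

end

theorem proposition4p4:
  fixes m :: nat
    and E :: "nat \<Rightarrow> ('k::real_normed_field, 'e) nspace"
    and F :: "('k, 'f) nspace"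
    and T :: "(nat \<Rightarrow> 'e) \<Rightarrow> 'f"
  assumes "1 \<le> m"
    and "\<And>i. i \<in> {1..m} \<Longrightarrow> banach_space (E i)"
    and "banach_space F"
    and "T \<in> cont_multilinear m E F"
  shows "T \<in> WDPstar_ev m E F \<longleftrightarrow>
    (\<forall>a\<in>(\<Pi>\<^sub>E i\<in>{1..m}. carrier (E i)).
     \<forall>x. (\<forall>i\<in>{1..m}. weakly_converges (E i) (x i) \<zero>\<^bsub>E i\<^esub>) \<longrightarrow>
     (\<forall>f g. weak_star_converges F f g \<longrightarrow>
       (\<lambda>j. f j (T (\<lambda>i\<in>{1..m}. x i j \<oplus>\<^bsub>E i\<^esub> a i))) \<longlonglongrightarrow> g (T a)))"
    (is "_ \<longleftrightarrow> ?R")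
proof -
  have E: "normed_space (E i)" if "i \<in> {1..m}" for i
    using assms(2)[OF that] by (rule banach_space.axioms)
  show ?thesis
  proof
    assume T: "T \<in> WDPstar_ev m E F"
    show ?R
    proof (intro ballI allI impI)
      fix a x f g
      assume a: "a \<in> (\<Pi>\<^sub>E i\<in>{1..m}. carrier (E i))"
        and x: "\<forall>i\<in>{1..m}. weakly_converges (E i) (x i) \<zero>\<^bsub>E i\<^esub>"
        and fg: "weak_star_converges F f g"
      have "\<forall>i\<in>{1..m}. weakly_converges (E i) (\<lambda>j. x i j \<oplus>\<^bsub>E i\<^esub> a i) (a i)"
        using a x normed_space.weakly_converges_add_const[OF E] by (auto simp: PiE_iff)
      then show "(\<lambda>j. f j (T (\<lambda>i\<in>{1..m}. x i j \<oplus>\<^bsub>E i\<^esub> a i))) \<longlonglongrightarrow> g (T a)"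
        using T a fg unfolding WDPstar_ev_def
        \<comment> \<open>The defining property is used at the base point \<open>a\<close> for the
          translated sequences; \<open>f\<close> and \<open>g\<close> stay the same.\<close>
        by (auto dest!: bspec[of _ _ a] spec[of _ "\<lambda>i j. x i j \<oplus>\<^bsub>E i\<^esub> a i"])
    qed
  next
    assume R: ?R
    have "(\<lambda>j. f j (T (\<lambda>i\<in>{1..m}. x i j))) \<longlonglongrightarrow> g (T a)"
      if a: "a \<in> (\<Pi>\<^sub>E i\<in>{1..m}. carrier (E i))"
        and x: "\<forall>i\<in>{1..m}. weakly_converges (E i) (x i) (a i)"
        and fg: "weak_star_converges F f g" for a x f g
    proof -
      have null: "\<forall>i\<in>{1..m}. weakly_converges (E i) (\<lambda>j. x i j \<ominus>\<^bsub>E i\<^esub> a i) \<zero>\<^bsub>E i\<^esub>"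
        using x normed_space.weakly_converges_minus_limit[OF E] by auto
      \<comment> \<open>Cancellation requires membership in the carrier, so it is proved for indices
        in \<open>{1..m}\<close> only. This suffices, since the tuples given to \<open>T\<close> are
        restricted to that set.\<close>
      have "x i j \<ominus>\<^bsub>E i\<^esub> a i \<oplus>\<^bsub>E i\<^esub> a i = x i j" if i: "i \<in> {1..m}" for i j
      proof -
        interpret normed_space "E i" by (rule E[OF i])
        have "x i j \<in> carrier (E i)" "a i \<in> carrier (E i)"
          using bspec[OF x i] by (auto simp: weakly_converges_iff)
        then show ?thesis
          by (simp add: a_minus_def M.a_assoc M.l_neg)
      qed
      then have "(\<lambda>i\<in>{1..m}. x i j \<ominus>\<^bsub>E i\<^esub> a i \<oplus>\<^bsub>E i\<^esub> a i) = (\<lambda>i\<in>{1..m}. x i j)" for j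
        by (rule restrict_ext)
      moreover have "(\<lambda>j. f j (T (\<lambda>i\<in>{1..m}. x i j \<ominus>\<^bsub>E i\<^esub> a i \<oplus>\<^bsub>E i\<^esub> a i))) \<longlonglongrightarrow> g (T a)"
        \<comment> \<open>The witness is the family of differences from the limits, weakly null by
          \<open>null\<close>; adding \<open>a i\<close> back recovers the original
          sequences.\<close>
        using R[rule_format, where x = "\<lambda>i j. x i j \<ominus>\<^bsub>E i\<^esub> a i", OF a _ fg] null by blast
      ultimately show ?thesis
        by simp
    qed
    then show "T \<in> WDPstar_ev m E F"
      using assms(4) unfolding WDPstar_ev_def by blast
  qed
qed

end
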